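(* Let $U=[U_{i,j}]_{i,j\ge0}$ be an irreducible almost upper-triangular transition matrix on $\mathbb N$, with invariant measure $\pi$, and define $L=[L_{i,j}]_{i,j\ge0}$ by $$L_{i,j}=\pi_jU_{j,i}/\pi_i .$$ (i) $L$ is an irreducible almost lower-triangular transition matrix on $\mathbb N$, with invariant measure $\pi$ too. (ii) $L$ is recurrent if and only if $U$ is recurrent. (iii) If $\pi$ is a probability distribution and $(Y_k,k\in\mathbb Z)$ is a Markov chain with transition matrix $U$ under its stationary regime (that is, $Y_k\sim\pi$ for every $k\in\mathbb Z$), then its time-reversal $(Y_{-k},k\in\mathbb Z)$ is a Markov chain with transition matrix $L$ under its stationary regime. (iv) $L$ is positive recurrent if and only if $U$ is positive recurrent.
   Context: $\mathbb N=\{0,1,2,\dots\}$. A transition matrix $M=[M_{i,j}]_{i,j\ge0}$ on $\mathbb N$ (non-negative entries, rows summing to $1$) is almost upper-triangular if $M_{i,j}>0\Rightarrow j\ge i-1$, and almost lower-triangular if $M_{i,j}>0\Rightarrow j\le i+1$. Invariant measures are non-negative measures on $\mathbb N$ with total mass in $(0,+\infty]$ such that $\sum_a\pi_aM_{a,b}=\pi_b$ for all $b$. An irreducible almost upper-triangular transition matrix has an invariant measure, which is positive and unique up to a positive factor. *)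

theory Defs
  imports "HOL-Probability.Probability"
begin

definition transition_matrix :: "(nat \<Rightarrow> nat \<Rightarrow> real) \<Rightarrow> bool" where
  "transition_matrix M \<longleftrightarrow> (\<forall>i j. 0 \<le> M i j) \<and> (\<forall>i. M i sums 1)"

text \<open>The bound is \<open>j \<ge> i - 1\<close>, written without truncated subtraction.\<close>

definition almost_upper_triangular :: "(nat \<Rightarrow> nat \<Rightarrow> real) \<Rightarrow> bool" where
  "almost_upper_triangular M \<longleftrightarrow> (\<forall>i j. M i j > 0 \<longrightarrow> i \<le> j + 1)"

definition almost_lower_triangular :: "(nat \<Rightarrow> nat \<Rightarrow> real) \<Rightarrow> bool" where
  "almost_lower_triangular M \<longleftrightarrow> (\<forall>i j. M i j > 0 \<longrightarrow> j \<le> i + 1)"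

primrec mat_power :: "(nat \<Rightarrow> nat \<Rightarrow> real) \<Rightarrow> nat \<Rightarrow> nat \<Rightarrow> nat \<Rightarrow> real" where
  "mat_power M 0 = (\<lambda>i j. if i = j then 1 else 0)"
| "mat_power M (Suc n) = (\<lambda>i j. \<Sum>k. M i k * mat_power M n k j)"

definition irreducible_matrix :: "(nat \<Rightarrow> nat \<Rightarrow> real) \<Rightarrow> bool" where
  "irreducible_matrix M \<longleftrightarrow> (\<forall>i j. \<exists>n. mat_power M n i j > 0)"

text \<open>
  A measure on the natural numbers is given by its weights. The weights are finite, the total
  mass may be infinite but not zero.
\<close>

definition invariant_measure :: "(nat \<Rightarrow> nat \<Rightarrow> real) \<Rightarrow> (nat \<Rightarrow> real) \<Rightarrow> bool" where
  "invariant_measure M \<pi> \<longleftrightarrow>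
     (\<forall>a. 0 \<le> \<pi> a) \<and> 0 < (\<Sum>a. ennreal (\<pi> a)) \<and> (\<forall>b. (\<lambda>a. \<pi> a * M a b) sums \<pi> b)"

text \<open>
  The law, on the space of trajectories, of the Markov chain with transition matrix \<open>M\<close>
  started at \<open>i\<close>. It is built by the Ionescu-Tulcea theorem from the kernels giving the
  conditional law of the state at time \<open>n\<close> given the states at times \<open>0, \<dots>, n - 1\<close>.
\<close>

definition chain_kernel ::
  "(nat \<Rightarrow> nat \<Rightarrow> real) \<Rightarrow> nat \<Rightarrow> nat \<Rightarrow> (nat \<Rightarrow> nat) \<Rightarrow> nat measure" where
  "chain_kernel M i n \<omega> = (case n of
       0 \<Rightarrow> return (count_space UNIV) i
     | Suc m \<Rightarrow> density (count_space UNIV) (\<lambda>j. ennreal (M (\<omega> m) j)))"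

definition chain_law :: "(nat \<Rightarrow> nat \<Rightarrow> real) \<Rightarrow> nat \<Rightarrow> (nat \<Rightarrow> nat) measure" where
  "chain_law M i = projective_family.lim UNIV
     (Ionescu_Tulcea.CI (chain_kernel M i) (\<lambda>_. count_space UNIV)) (\<lambda>_. count_space UNIV)"

lemma Ionescu_Tulcea_chain_kernel:
  assumes "transition_matrix M"
  shows "Ionescu_Tulcea (chain_kernel M i) (\<lambda>_. count_space UNIV)"
proof (rule Ionescu_Tulcea.intro)
  have prob: "prob_space (density (count_space UNIV) (\<lambda>j. ennreal (M k j)))" for k
  proof
    have "(\<Sum>j. ennreal (M k j)) = ennreal 1"
      using assms by (intro suminf_ennreal_eq) (auto simp: transition_matrix_def)
    then show "emeasure (density (count_space UNIV) (\<lambda>j. ennreal (M k j)))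
        (space (density (count_space UNIV) (\<lambda>j. ennreal (M k j)))) = 1"
      by (simp add: emeasure_density nn_integral_count_space_nat)
  qed
  show "prob_space (chain_kernel M i n x)" for n x
    using prob by (auto simp: chain_kernel_def intro!: prob_space_return split: nat.split)
  show "chain_kernel M i n \<in>
      measurable (PiM {0..<n} (\<lambda>_. count_space UNIV)) (subprob_algebra (count_space UNIV))" for n
  proof (cases n)
    case 0
    then show ?thesis
      by (auto simp: chain_kernel_def[abs_def] space_subprob_algebra
          intro!: measurable_const prob_space_imp_subprob_space prob_space_return)
  next
    case (Suc m)
    have "(\<lambda>\<omega>. \<omega> m) \<in> measurable (PiM {0..<n} (\<lambda>_. count_space UNIV)) (count_space UNIV)"
      using Suc by (intro measurable_component_singleton) auto
    moreover have "(\<lambda>k. density (count_space UNIV) (\<lambda>j. ennreal (M k j))) \<in>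
        measurable (count_space UNIV) (subprob_algebra (count_space UNIV))"
      using prob by (auto simp: space_subprob_algebra intro: prob_space_imp_subprob_space)
    ultimately have "(\<lambda>\<omega>. density (count_space UNIV) (\<lambda>j. ennreal (M (\<omega> m) j))) \<in>
        measurable (PiM {0..<n} (\<lambda>_. count_space UNIV)) (subprob_algebra (count_space UNIV))"
      by (rule measurable_compose)
    then show ?thesis
      using Suc by (simp add: chain_kernel_def[abs_def])
  qed
qed

lemma prob_space_chain_law:
  assumes "transition_matrix M"
  shows "prob_space (chain_law M i)" and
    "sets (chain_law M i) = sets (PiM UNIV (\<lambda>_. count_space UNIV))"
proof -
  interpret IT: Ionescu_Tulcea "chain_kernel M i" "\<lambda>_. count_space UNIV"
    by (rule Ionescu_Tulcea_chain_kernel[OF assms])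
  show s: "sets (chain_law M i) = sets (PiM UNIV (\<lambda>_. count_space UNIV))"
    by (simp add: chain_law_def)
  have "prob_space (distr (chain_law M i) (PiM {} (\<lambda>_. count_space UNIV)) (\<lambda>x. restrict x {}))"
    using IT.distr_lim[of "{}"] IT.PF.prob_space_P[of "{}"] by (simp add: chain_law_def)
  then show "prob_space (chain_law M i)"
    by (rule prob_space_distrD[rotated])
       (auto simp: measurable_cong_sets[OF s refl] intro!: measurable_restrict)
qed

lemma emeasure_chain_law:
  assumes "transition_matrix M"
  shows "emeasure (chain_law M i) {\<omega>. \<forall>k\<le>n. \<omega> k = x k} =
     (if x 0 = i then \<Prod>k<n. ennreal (M (x k) (x (Suc k))) else 0)"
proof -
  interpret IT: Ionescu_Tulcea "chain_kernel M i" "\<lambda>_. count_space UNIV"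
    by (rule Ionescu_Tulcea_chain_kernel[OF assms])
  let ?P = "\<lambda>n. PiM {0..<n} (\<lambda>_. count_space (UNIV :: nat set))"
  let ?S = "\<lambda>n. PiE {0..<n} (\<lambda>k. {x k})"
  have S[measurable]: "?S n \<in> sets (?P n)" for n
    by (rule sets_PiM_I_finite) auto
  have u[simp]: "(\<lambda>_. undefined) \<in> space (?P 0)"
    by (simp add: space_PiM PiE_def extensional_def)
  have eP: "emeasure (IT.eP n \<omega>) (?S (Suc n)) =
      indicator (?S n) \<omega> * emeasure (chain_kernel M i n \<omega>) {x n}" if "\<omega> \<in> space (?P n)" for n \<omega>
  proof -
    have "fun_upd \<omega> n -` ?S (Suc n) = (if \<omega> \<in> ?S n then {x n} else {})"
      using that
      by (auto simp: space_PiM PiE_iff extensional_def less_Suc_eq split: if_splits)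
    then show ?thesis
      using that by (simp add: IT.emeasure_eP split: split_indicator)
  qed
  have C: "emeasure (IT.C 0 (Suc n) (\<lambda>_. undefined)) (?S (Suc n)) =
      emeasure (IT.C 0 n (\<lambda>_. undefined)) (?S n) * emeasure (chain_kernel M i n x) {x n}" for n
  proof -
    have "emeasure (IT.C 0 (Suc n) (\<lambda>_. undefined)) (?S (Suc n)) =
        (\<integral>\<^sup>+\<omega>. emeasure (IT.eP n \<omega>) (?S (Suc n)) \<partial>IT.C 0 n (\<lambda>_. undefined))"
      using IT.measurable_eP[of n] IT.sets_C[OF u, of n]
      by (simp, subst emeasure_bind[where N="?P (Suc n)"])
         (auto simp: IT.space_C space_PiM cong: measurable_cong_sets)
    also have "\<dots> = (\<integral>\<^sup>+\<omega>. emeasure (chain_kernel M i n x) {x n} * indicator (?S n) \<omega>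
        \<partial>IT.C 0 n (\<lambda>_. undefined))"
    proof (rule nn_integral_cong)
      fix \<omega> assume "\<omega> \<in> space (IT.C 0 n (\<lambda>_. undefined))"
      then have w: "\<omega> \<in> space (?P n)"
        using IT.space_C[OF u, of n] by simp
      have "chain_kernel M i n \<omega> = chain_kernel M i n x" if "\<omega> \<in> ?S n"
        using that by (cases n) (auto simp: chain_kernel_def PiE_iff)
      then show "emeasure (IT.eP n \<omega>) (?S (Suc n)) =
          emeasure (chain_kernel M i n x) {x n} * indicator (?S n) \<omega>"
        by (simp add: eP[OF w] split: split_indicator)
    qed
    also have "\<dots> = emeasure (IT.C 0 n (\<lambda>_. undefined)) (?S n) *
        emeasure (chain_kernel M i n x) {x n}"
      using S[of n] IT.sets_C[OF u, of n]
      by (subst nn_integral_cmult_indicator) (auto simp: mult.commute)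
    finally show ?thesis .
  qed
  have "emeasure (IT.C 0 (Suc n) (\<lambda>_. undefined)) (?S (Suc n)) =
      (if x 0 = i then \<Prod>k<n. ennreal (M (x k) (x (Suc k))) else 0)"
  proof (induction n)
    case 0
    have "emeasure (IT.C 0 0 (\<lambda>_. undefined)) (?S 0) = 1"
      using S[of 0] by (simp add: emeasure_return)
    then show ?case
      unfolding C[of 0] by (auto simp: chain_kernel_def emeasure_return split: split_indicator)
  next
    case (Suc n)
    have "emeasure (chain_kernel M i (Suc n) x) {x (Suc n)} = ennreal (M (x n) (x (Suc n)))"
      by (simp add: chain_kernel_def emeasure_density)
    then show ?case
      unfolding C[of "Suc n"] Suc.IH by simp
  qed
  moreover have "emeasure (chain_law M i) (prod_emb UNIV (\<lambda>_. count_space UNIV) {0..<Suc n} (?S (Suc n))) =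
      emeasure (IT.C 0 (Suc n) (\<lambda>_. undefined)) (?S (Suc n))"
    unfolding chain_law_def
    by (subst IT.lim) (auto simp: IT.emeasure_CI[of _ "Suc n"] prod_emb_id space_PiM
        simp del: IT.C.simps intro!: sets_PiM_I_finite arg_cong[where f="emeasure _"])
  moreover have "prod_emb UNIV (\<lambda>_. count_space UNIV) {0..<Suc n} (?S (Suc n)) =
      {\<omega>. \<forall>k\<le>n. \<omega> k = x k}"
    by (auto simp: prod_emb_def PiE_iff less_Suc_eq_le space_PiM)
  ultimately show ?thesis by simp
qed

definition return_time :: "nat \<Rightarrow> (nat \<Rightarrow> nat) \<Rightarrow> enat" where
  "return_time i \<omega> = (INF n\<in>{n. 1 \<le> n \<and> \<omega> n = i}. enat n)"

definition recurrent :: "(nat \<Rightarrow> nat \<Rightarrow> real) \<Rightarrow> bool" where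
  "recurrent M \<longleftrightarrow> (\<forall>i. AE \<omega> in chain_law M i. return_time i \<omega> < \<infinity>)"

text \<open>A finite mean return time forces the return time to be finite almost surely.\<close>

definition positive_recurrent :: "(nat \<Rightarrow> nat \<Rightarrow> real) \<Rightarrow> bool" where
  "positive_recurrent M \<longleftrightarrow>
     (\<forall>i. (\<integral>\<^sup>+\<omega>. ennreal_of_enat (return_time i \<omega>) \<partial>chain_law M i) < \<infinity>)"

text \<open>
  Markov chains indexed by the integers: the conditional law of the next state, given any finite
  stretch of the past ending at the present, is the row of \<open>M\<close> at the present state.
\<close>

definition markov_chain ::
  "'w measure \<Rightarrow> (nat \<Rightarrow> nat \<Rightarrow> real) \<Rightarrow> (int \<Rightarrow> 'w \<Rightarrow> nat) \<Rightarrow> bool" where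
  "markov_chain P M X \<longleftrightarrow>
     prob_space P \<and>
     (\<forall>k. X k \<in> measurable P (count_space UNIV)) \<and>
     (\<forall>k n x. \<P>(\<omega> in P. \<forall>l\<in>{k - int n..k}. X l \<omega> = x l) > 0 \<longrightarrow>
        \<P>(\<omega> in P. X (k + 1) \<omega> = x (k + 1) \<bar> \<forall>l\<in>{k - int n..k}. X l \<omega> = x l)
          = M (x k) (x (k + 1)))"

definition stationary_markov_chain ::
  "'w measure \<Rightarrow> (nat \<Rightarrow> nat \<Rightarrow> real) \<Rightarrow> (nat \<Rightarrow> real) \<Rightarrow> (int \<Rightarrow> 'w \<Rightarrow> nat) \<Rightarrow> bool" where
  "stationary_markov_chain P M \<pi> X \<longleftrightarrow>
     markov_chain P M X \<and> (\<forall>k i. \<P>(\<omega> in P. X k \<omega> = i) = \<pi> i)"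

end

theory Submission
  imports Defs
begin

text \<open>
  The weight of a path is the product of the transition probabilities along it. The weight of a
  path for \<open>U\<close> and that of the reversed path for \<open>L\<close> differ by the ratio of \<open>\<pi>\<close> at the two ends only:
  in the product of the factors \<open>L a b = \<pi> b * U b a / \<pi> a\<close> the values of \<open>\<pi>\<close> telescope
  (\<open>prod_time_reversal\<close>). This requires \<open>\<pi>\<close> to be positive everywhere, which irreducibility
  provides (\<open>invariant_measure_pos\<close>).

  The one-step case says that \<open>L\<close> has the edges of \<open>U\<close> reversed; this gives irreducibility and the
  triangular shape. The two sums to be checked, the row sums of \<open>L\<close> and the invariance of \<open>\<pi>\<close>
  under \<open>L\<close>, are the invariance of \<open>\<pi>\<close> under \<open>U\<close> and the row sums of \<open>U\<close>.

  For a loop at \<open>i\<close> the two ends agree, so it has the same weight for \<open>L\<close> as the reversed loop has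
  for \<open>U\<close>. Reversal permutes the loops of length \<open>n\<close> which visit \<open>i\<close> at their ends only, and the
  total weight of these loops is the probability that the return time to \<open>i\<close> equals \<open>n\<close>. Hence the
  return time to \<open>i\<close> has the same law for both chains (\<open>distr_return_time_time_reversal\<close>), and
  recurrence and positive recurrence depend on that law only.

  For a stationary chain, the probability of a finite path is \<open>\<pi>\<close> at its first state times the
  weight of the path. Prepending one state \<open>b\<close> to a path which starts at \<open>a\<close> multiplies this by
  \<open>\<pi> b * U b a / \<pi> a\<close>, which is therefore the conditional probability of a step backwards.
\<close>

section \<open>Irreducibility as connectedness\<close>

definition edges :: "(nat \<Rightarrow> nat \<Rightarrow> real) \<Rightarrow> (nat \<times> nat) set" where
  "edges M = {(a, b). 0 < M a b}"

lemma mat_power_bounds: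
  assumes "transition_matrix M"
  shows "0 \<le> mat_power M n i j \<and> mat_power M n i j \<le> 1"
proof (induction n arbitrary: i)
  case (Suc n)
  have M: "0 \<le> M i k" "M i sums 1" for k
    using assms by (auto simp: transition_matrix_def)
  have le: "M i k * mat_power M n k j \<le> M i k" for k
    using M(1)[of k] Suc.IH[of k] by (simp add: mult_left_le)
  have nonneg: "0 \<le> M i k * mat_power M n k j" for k
    using M(1)[of k] Suc.IH[of k] by simp
  have "summable (\<lambda>k. M i k * mat_power M n k j)"
    by (rule summable_comparison_test'[OF sums_summable[OF M(2)], of 0]) (use le nonneg in auto)
  then show ?case
    using suminf_le[OF le _ sums_summable[OF M(2)]] suminf_nonneg[OF _ nonneg] sums_unique[OF M(2)]
    by simp
qed simp

lemma mat_power_Suc_pos_iff: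
  assumes "transition_matrix M"
  shows "0 < mat_power M (Suc n) i j \<longleftrightarrow> (\<exists>k. 0 < M i k \<and> 0 < mat_power M n k j)"
proof -
  have M: "0 \<le> M i k" "summable (M i)" for k
    using assms by (auto simp: transition_matrix_def sums_iff)
  note P = mat_power_bounds[OF assms]
  have nonneg: "0 \<le> M i k * mat_power M n k j" for k
    using M(1)[of k] P[of n k j] by simp
  have "summable (\<lambda>k. M i k * mat_power M n k j)"
    by (rule summable_comparison_test'[OF M(2), of 0])
       (use M(1) P nonneg in \<open>auto simp: mult_left_le\<close>)
  then have "0 < mat_power M (Suc n) i j \<longleftrightarrow> (\<exists>k. 0 < M i k * mat_power M n k j)"
    using nonneg by (simp add: suminf_pos_iff)
  also have "\<dots> \<longleftrightarrow> (\<exists>k. 0 < M i k \<and> 0 < mat_power M n k j)"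
    using M(1) P by (auto simp: zero_less_mult_iff not_less[symmetric])
  finally show ?thesis .
qed

lemma irreducible_matrix_iff_edges:
  assumes "transition_matrix M"
  shows "irreducible_matrix M \<longleftrightarrow> (edges M)\<^sup>* = UNIV"
proof -
  have "0 < mat_power M n i j \<longleftrightarrow> (i, j) \<in> edges M ^^ n" for n i j
  proof (induction n arbitrary: i)
    case (Suc n)
    then show ?case
      unfolding mat_power_Suc_pos_iff[OF assms] relpow.simps(2) relpow_commute[symmetric]
      by (auto simp: edges_def)
  qed simp
  then show ?thesis
    by (auto simp: irreducible_matrix_def rtrancl_power)
qed

text \<open>
  By invariance a state has at least the mass which any single edge carries into it, so positive
  mass spreads from the states that have it to all states reachable from them.
\<close>

lemma invariant_measure_pos:
  assumes M: "transition_matrix M" "irreducible_matrix M" and inv: "invariant_measure M \<pi>"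
  shows "0 < \<pi> i"
proof -
  have nonneg: "0 \<le> \<pi> a" "0 \<le> M a b" for a b
    using M inv by (auto simp: invariant_measure_def transition_matrix_def)
  have "\<exists>a. 0 < \<pi> a"
  proof (rule ccontr)
    assume "\<nexists>a. 0 < \<pi> a"
    then have "\<pi> = (\<lambda>_. 0)"
      using nonneg by (auto simp: fun_eq_iff not_less intro: antisym)
    then show False
      using inv by (simp add: invariant_measure_def)
  qed
  then obtain a where "0 < \<pi> a" ..
  have "(a, i) \<in> (edges M)\<^sup>*"
    using M by (simp add: irreducible_matrix_iff_edges)
  then show ?thesis
  proof induction
    case base
    show ?case by fact
  next
    case (step b c)
    have "(\<lambda>a. \<pi> a * M a c) sums \<pi> c"
      using inv by (simp add: invariant_measure_def)
    then have "\<pi> b * M b c \<le> \<pi> c"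
      using sum_le_suminf[of "\<lambda>a. \<pi> a * M a c" "{b}"] nonneg by (auto simp: sums_iff)
    moreover have "0 < \<pi> b * M b c"
      using step by (simp add: edges_def)
    ultimately show ?case by simp
  qed
qed

section \<open>The time-reversed matrix\<close>

definition time_reversal :: "(nat \<Rightarrow> real) \<Rightarrow> (nat \<Rightarrow> nat \<Rightarrow> real) \<Rightarrow> nat \<Rightarrow> nat \<Rightarrow> real" where
  "time_reversal \<pi> M i j = \<pi> j * M j i / \<pi> i"

lemma transition_matrix_time_reversal:
  assumes "transition_matrix M" "invariant_measure M \<pi>" and pos: "\<And>i. 0 < \<pi> i"
  shows "transition_matrix (time_reversal \<pi> M)"
  unfolding transition_matrix_def
proof (intro conjI allI)
  fix i j
  show "0 \<le> time_reversal \<pi> M i j"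
    using assms less_imp_le[OF pos] by (simp add: time_reversal_def transition_matrix_def)
  have "(\<lambda>j. \<pi> j * M j i / \<pi> i) sums (\<pi> i / \<pi> i)"
    using assms by (intro sums_divide) (simp add: invariant_measure_def)
  then show "time_reversal \<pi> M i sums 1"
    using pos[of i] by (simp add: time_reversal_def[abs_def])
qed

lemma invariant_measure_time_reversal:
  assumes "transition_matrix M" "invariant_measure M \<pi>" and pos: "\<And>i. 0 < \<pi> i"
  shows "invariant_measure (time_reversal \<pi> M) \<pi>"
proof -
  have "(\<lambda>a. \<pi> a * time_reversal \<pi> M a b) sums \<pi> b" for b
  proof -
    have "(\<lambda>a. \<pi> b * M b a) sums (\<pi> b * 1)"
      using assms by (intro sums_mult) (simp add: transition_matrix_def)
    moreover have "\<pi> a * time_reversal \<pi> M a b = \<pi> b * M b a" for a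
      using pos[of a] by (simp add: time_reversal_def)
    ultimately show ?thesis by simp
  qed
  then show ?thesis
    using assms by (simp add: invariant_measure_def)
qed

lemma edges_time_reversal:
  assumes pos: "\<And>i. 0 < \<pi> i"
  shows "edges (time_reversal \<pi> M) = (edges M)\<inverse>"
  using pos by (auto simp: edges_def time_reversal_def zero_less_mult_iff zero_less_divide_iff
      dest: less_asym)

lemma irreducible_matrix_time_reversal:
  assumes "transition_matrix M" "irreducible_matrix M" "invariant_measure M \<pi>"
    and pos: "\<And>i. 0 < \<pi> i"
  shows "irreducible_matrix (time_reversal \<pi> M)"
proof -
  have "((edges M)\<inverse>)\<^sup>* = UNIV"
    using assms by (simp add: rtrancl_converse irreducible_matrix_iff_edges)
  then show ?thesis
    using assms by (simp add: irreducible_matrix_iff_edges transition_matrix_time_reversal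
        edges_time_reversal)
qed

lemma almost_lower_triangular_time_reversal:
  assumes "almost_upper_triangular M" and pos: "\<And>i. 0 < \<pi> i"
  shows "almost_lower_triangular (time_reversal \<pi> M)"
  using assms(1) edges_time_reversal[of \<pi> M, OF pos]
  by (auto simp: almost_lower_triangular_def almost_upper_triangular_def edges_def set_eq_iff)

text \<open>
  Each inner state of the path \<open>y\<close> puts its weight \<open>\<pi>\<close> once into a numerator and once into a
  denominator, so that only the two end states remain.
\<close>

lemma prod_time_reversal:
  fixes \<pi> :: "nat \<Rightarrow> real"
  assumes pos: "\<And>i. 0 < \<pi> i"
  shows "\<pi> (y n) * (\<Prod>k<n. time_reversal \<pi> M (y (Suc k)) (y k))
    = \<pi> (y 0) * (\<Prod>k<n. M (y k) (y (Suc k)))"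
proof (induction n)
  case (Suc n)
  have "\<pi> (y (Suc n)) * (\<Prod>k<Suc n. time_reversal \<pi> M (y (Suc k)) (y k))
      = M (y n) (y (Suc n)) * (\<pi> (y n) * (\<Prod>k<n. time_reversal \<pi> M (y (Suc k)) (y k)))"
    using pos[of "y (Suc n)"] by (simp add: time_reversal_def)
  then show ?case
    by (simp add: Suc.IH)
qed simp

section \<open>The law of the return time\<close>

lemma return_time_eq_enat_iff:
  "return_time i \<omega> = enat n \<longleftrightarrow> 1 \<le> n \<and> \<omega> n = i \<and> (\<forall>k. 1 \<le> k \<and> k < n \<longrightarrow> \<omega> k \<noteq> i)"
  (is "_ \<longleftrightarrow> ?R")
proof
  let ?A = "enat ` {n. 1 \<le> n \<and> \<omega> n = i}"
  assume eq: "return_time i \<omega> = enat n"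
  have "?A \<noteq> {}"
  proof
    assume "?A = {}"
    then have "return_time i \<omega> = \<infinity>"
      unfolding return_time_def by (simp only: Inf_enat_def simp_thms if_True)
    then show False
      using eq by simp
  qed
  then have "Inf ?A \<in> ?A"
    unfolding Inf_enat_def by (metis (mono_tags) LeastI all_not_in_conv)
  then have n: "1 \<le> n" "\<omega> n = i"
    using eq by (auto simp: return_time_def)
  have "\<omega> k \<noteq> i" if "1 \<le> k" "k < n" for k
  proof
    assume "\<omega> k = i"
    then have "return_time i \<omega> \<le> enat k"
      using that unfolding return_time_def by (intro INF_lower) auto
    then show False
      using eq that by simp
  qed
  with n show ?R by blast
next
  assume R: ?R
  show "return_time i \<omega> = enat n"
    unfolding return_time_def
  proof (rule antisym)
    show "(INF n\<in>{n. 1 \<le> n \<and> \<omega> n = i}. enat n) \<le> enat n"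
      using R by (intro INF_lower) auto
    show "enat n \<le> (INF n\<in>{n. 1 \<le> n \<and> \<omega> n = i}. enat n)"
      using R by (intro INF_greatest) (auto simp: not_less[symmetric])
  qed
qed

lemma measurable_return_time:
  "return_time i \<in> measurable (PiM UNIV (\<lambda>_. count_space UNIV)) (count_space UNIV)"
proof -
  let ?S = "PiM UNIV (\<lambda>_. count_space UNIV) :: (nat \<Rightarrow> nat) measure"
  have fin: "return_time i -` {enat n} \<inter> space ?S \<in> sets ?S" for n
  proof -
    have [measurable]: "(\<lambda>\<omega>. \<omega> k) \<in> measurable ?S (count_space UNIV)" for k
      by (rule measurable_component_singleton) simp
    have "{\<omega> \<in> space ?S. 1 \<le> n \<and> \<omega> n = i \<and> (\<forall>k. 1 \<le> k \<and> k < n \<longrightarrow> \<omega> k \<noteq> i)} \<in> sets ?S"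
      by measurable
    then show ?thesis
      by (simp add: vimage_def return_time_eq_enat_iff Int_def conj_commute)
  qed
  have "return_time i -` {t} \<inter> space ?S \<in> sets ?S" for t
  proof (cases t)
    case infinity
    have "return_time i -` {t} \<inter> space ?S
        = space ?S - (\<Union>n. return_time i -` {enat n} \<inter> space ?S)"
      by (auto simp: infinity not_enat_eq)
    also have "\<dots> \<in> sets ?S"
      by (intro sets.compl_sets sets.countable_UN) (use fin in auto)
    finally show ?thesis .
  qed (simp add: fin)
  then show ?thesis
    by (subst measurable_count_space_eq2_countable) auto
qed

lemma measurable_return_time_chain_law:
  assumes "transition_matrix M"
  shows "return_time i \<in> measurable (chain_law M j) (count_space UNIV)"
  using measurable_return_time
  by (simp add: measurable_cong_sets[OF prob_space_chain_law(2)[OF assms] refl])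

text \<open>
  The excursions of length \<open>n\<close> from \<open>i\<close>. They are lists, hence countably many, so that the
  event of a return at time \<open>n\<close> is a countable disjoint union of cylinders.
\<close>

definition loops :: "nat \<Rightarrow> nat \<Rightarrow> nat list set" where
  "loops i n = {xs. length xs = Suc n \<and> xs ! 0 = i \<and> xs ! n = i \<and>
     (\<forall>k. 1 \<le> k \<and> k < n \<longrightarrow> xs ! k \<noteq> i)}"

lemma rev_loops: "rev xs \<in> loops i n" if "xs \<in> loops i n"
  using that by (auto simp: loops_def rev_nth)

lemma bij_betw_rev_loops: "bij_betw rev (loops i n) (loops i n)"
  by (rule bij_betw_byWitness[where f'=rev]) (auto intro: rev_loops)

text \<open>
  The return time is a function of the states from time \<open>1\<close> on, while the loops also prescribe the
  state \<open>i\<close> at time \<open>0\<close>. The two events agree up to a null set, since the chain starts at \<open>i\<close>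
  almost surely.
\<close>

lemma emeasure_return_time:
  assumes M: "transition_matrix M" and n: "1 \<le> n"
  shows "emeasure (chain_law M i) (return_time i -` {enat n} \<inter> space (chain_law M i))
    = (\<integral>\<^sup>+xs. ennreal (\<Prod>k<n. M (xs ! k) (xs ! Suc k)) \<partial>count_space (loops i n))"
proof -
  interpret prob_space "chain_law M i"
    by (rule prob_space_chain_law[OF M])
  note sets = prob_space_chain_law(2)[OF M, of i]
  have space[simp]: "space (chain_law M i) = UNIV"
    using sets_eq_imp_space_eq[OF sets] by (simp add: space_PiM)
  have [measurable]: "(\<lambda>\<omega>. \<omega> k) \<in> measurable (chain_law M i) (count_space UNIV)" for k
    by (subst measurable_cong_sets[OF sets refl]) (rule measurable_component_singleton, simp)
  let ?C = "\<lambda>xs. {\<omega>. \<forall>k\<le>n. \<omega> k = xs ! k}"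
  have C: "{\<omega>. \<forall>k\<le>m. \<omega> k = xs ! k} \<in> events" for m and xs :: "nat list"
  proof -
    have "{\<omega> \<in> space (chain_law M i). \<forall>k\<le>m. \<omega> k = xs ! k} \<in> events"
      by measurable
    then show ?thesis by simp
  qed
  have ret: "return_time i -` {enat n} \<in> events"
    using measurable_sets[OF measurable_return_time, of "{enat n}" i]
    by (simp add: sets space_PiM)
  have "emeasure (chain_law M i) {\<omega>. \<forall>k\<le>0. \<omega> k = i} = 1"
    using emeasure_chain_law[OF M, of i 0 "\<lambda>_. i"] by simp
  then have start: "AE \<omega> in chain_law M i. \<omega> 0 = i"
    using C[of 0 "[i]"] by (intro AE_I_eq_1) simp_all
  have "emeasure (chain_law M i) (return_time i -` {enat n})
      = emeasure (chain_law M i) (\<Union>xs\<in>loops i n. ?C xs)"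
  proof (rule emeasure_eq_AE)
    show "AE \<omega> in chain_law M i. \<omega> \<in> return_time i -` {enat n} \<longleftrightarrow> \<omega> \<in> (\<Union>xs\<in>loops i n. ?C xs)"
      using start
    proof eventually_elim
      case (elim \<omega>)
      show ?case
      proof
        assume "\<omega> \<in> return_time i -` {enat n}"
        then have "map \<omega> [0..<Suc n] \<in> loops i n"
          using elim by (auto simp: return_time_eq_enat_iff loops_def nth_append simp del: upt_Suc)
        moreover have "\<omega> \<in> ?C (map \<omega> [0..<Suc n])"
          by (simp del: upt_Suc)
        ultimately show "\<omega> \<in> (\<Union>xs\<in>loops i n. ?C xs)" by blast
      qed (use n in \<open>auto simp: return_time_eq_enat_iff loops_def\<close>)
    qed
  qed (use ret C in auto)
  also have "\<dots> = (\<integral>\<^sup>+xs. emeasure (chain_law M i) (?C xs) \<partial>count_space (loops i n))"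
  proof (rule emeasure_UN_countable)
    show "disjoint_family_on ?C (loops i n)"
      unfolding disjoint_family_on_def
    proof (intro ballI impI)
      fix xs ys assume xy: "xs \<in> loops i n" "ys \<in> loops i n" "xs \<noteq> ys"
      then obtain k where "k \<le> n" "xs ! k \<noteq> ys ! k"
        by (auto simp: loops_def list_eq_iff_nth_eq less_Suc_eq_le)
      then show "?C xs \<inter> ?C ys = {}" by auto
    qed
  qed (use C in auto)
  also have "\<dots> = (\<integral>\<^sup>+xs. ennreal (\<Prod>k<n. M (xs ! k) (xs ! Suc k)) \<partial>count_space (loops i n))"
  proof (rule nn_integral_cong)
    fix xs assume "xs \<in> space (count_space (loops i n))"
    then have "xs ! 0 = i" by (simp add: loops_def)
    moreover have "0 \<le> M a b" for a b
      using M by (simp add: transition_matrix_def)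
    ultimately show "emeasure (chain_law M i) (?C xs) = ennreal (\<Prod>k<n. M (xs ! k) (xs ! Suc k))"
      using emeasure_chain_law[OF M, of i n "\<lambda>k. xs ! k"] by (simp add: prod_ennreal)
  qed
  finally show ?thesis by simp
qed

lemma loop_weight_time_reversal:
  fixes \<pi> :: "nat \<Rightarrow> real"
  assumes pos: "\<And>i. 0 < \<pi> i" and xs: "xs \<in> loops i n"
  shows "(\<Prod>k<n. time_reversal \<pi> M (rev xs ! k) (rev xs ! Suc k)) = (\<Prod>k<n. M (xs ! k) (xs ! Suc k))"
proof -
  have len: "length xs = Suc n" and ends: "xs ! 0 = i" "xs ! n = i"
    using xs by (auto simp: loops_def)
  have "(\<Prod>k<n. time_reversal \<pi> M (rev xs ! k) (rev xs ! Suc k))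
      = (\<Prod>k<n. time_reversal \<pi> M (xs ! Suc (n - Suc k)) (xs ! (n - Suc k)))"
    by (rule prod.cong) (auto simp: rev_nth len Suc_diff_Suc)
  also have "\<dots> = (\<Prod>k<n. time_reversal \<pi> M (xs ! Suc k) (xs ! k))"
    by (rule prod.nat_diff_reindex)
  finally show ?thesis
    using prod_time_reversal[of \<pi> "\<lambda>k. xs ! k" n M, OF pos] pos[of i]
    by (simp add: ends)
qed

text \<open>
  The laws agree at each finite time, because reversing the excursions is a weight-preserving
  bijection; both laws have total mass one, so they also agree at infinity.
\<close>

lemma distr_return_time_time_reversal:
  assumes M: "transition_matrix M" and inv: "invariant_measure M \<pi>" and pos: "\<And>i. 0 < \<pi> i"
  shows "distr (chain_law (time_reversal \<pi> M) i) (count_space UNIV) (return_time i)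
    = distr (chain_law M i) (count_space UNIV) (return_time i)"
    (is "?D (time_reversal \<pi> M) = ?D M")
proof -
  let ?R = "time_reversal \<pi> M"
  have R: "transition_matrix ?R"
    using M inv pos by (rule transition_matrix_time_reversal)
  note meas = measurable_return_time_chain_law
  have prob: "prob_space (?D N)" if "transition_matrix N" for N
    using that by (intro prob_space.prob_space_distr prob_space_chain_law meas)
  have fin: "emeasure (?D ?R) {enat n} = emeasure (?D M) {enat n}" for n
  proof (cases "1 \<le> n")
    case True
    have "emeasure (?D ?R) {enat n}
        = (\<integral>\<^sup>+xs. ennreal (\<Prod>k<n. ?R (xs ! k) (xs ! Suc k)) \<partial>count_space (loops i n))"
      by (simp add: emeasure_distr meas[OF R] emeasure_return_time[OF R True])
    also have "\<dots> = (\<integral>\<^sup>+xs. ennreal (\<Prod>k<n. ?R (rev xs ! k) (rev xs ! Suc k)) \<partial>count_space (loops i n))"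
      by (rule nn_integral_bij_count_space[OF bij_betw_rev_loops, symmetric])
    also have "\<dots> = (\<integral>\<^sup>+xs. ennreal (\<Prod>k<n. M (xs ! k) (xs ! Suc k)) \<partial>count_space (loops i n))"
      by (intro nn_integral_cong) (simp add: loop_weight_time_reversal[of \<pi>, OF pos])
    also have "\<dots> = emeasure (?D M) {enat n}"
      by (simp add: emeasure_distr meas[OF M] emeasure_return_time[OF M True])
    finally show ?thesis .
  next
    case False
    then have "return_time i -` {enat n} = {}"
      by (auto simp: return_time_eq_enat_iff)
    then show ?thesis
      by (simp add: emeasure_distr meas M R)
  qed
  have inf: "emeasure (?D N) {\<infinity>} = 1 - (\<Sum>n. emeasure (?D N) {enat n})" if "transition_matrix N" for N
  proof -
    interpret prob_space "?D N" by (rule prob[OF that])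
    have "(\<Sum>n. emeasure (?D N) {enat n}) = emeasure (?D N) (\<Union>n. {enat n})"
      by (rule suminf_emeasure) (auto simp: disjoint_family_on_def)
    also have "(\<Union>n. {enat n}) = UNIV - {\<infinity>}"
      by (auto simp: not_enat_eq)
    finally show ?thesis
      using emeasure_compl[of "UNIV - {\<infinity>}" "?D N"] emeasure_space_1 by (simp add: double_diff)
  qed
  show ?thesis
  proof (rule measure_eqI_countable[of _ UNIV])
    fix t :: enat
    show "emeasure (?D ?R) {t} = emeasure (?D M) {t}"
      by (cases t) (simp_all add: fin inf M R)
  qed auto
qed

lemma AE_return_time_distr:
  assumes M: "transition_matrix M"
  shows "(AE \<omega> in chain_law M i. return_time i \<omega> < \<infinity>) \<longleftrightarrow>
    (AE t in distr (chain_law M i) (count_space UNIV) (return_time i). t < \<infinity>)"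
  by (rule AE_distr_iff[symmetric]) (simp_all add: measurable_return_time_chain_law M)

lemma nn_integral_return_time_distr:
  assumes M: "transition_matrix M"
  shows "(\<integral>\<^sup>+\<omega>. ennreal_of_enat (return_time i \<omega>) \<partial>chain_law M i) =
    (\<integral>\<^sup>+t. ennreal_of_enat t \<partial>distr (chain_law M i) (count_space UNIV) (return_time i))"
  by (rule nn_integral_distr[symmetric]) (simp_all add: measurable_return_time_chain_law M)

lemma recurrent_time_reversal:
  assumes "transition_matrix M" "invariant_measure M \<pi>" and "\<And>i. 0 < \<pi> i"
  shows "recurrent (time_reversal \<pi> M) \<longleftrightarrow> recurrent M"
  unfolding recurrent_def AE_return_time_distr[OF assms(1)]
    AE_return_time_distr[OF transition_matrix_time_reversal[OF assms]]
    distr_return_time_time_reversal[OF assms] ..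

lemma positive_recurrent_time_reversal:
  assumes "transition_matrix M" "invariant_measure M \<pi>" and "\<And>i. 0 < \<pi> i"
  shows "positive_recurrent (time_reversal \<pi> M) \<longleftrightarrow> positive_recurrent M"
  unfolding positive_recurrent_def nn_integral_return_time_distr[OF assms(1)]
    nn_integral_return_time_distr[OF transition_matrix_time_reversal[OF assms]]
    distr_return_time_time_reversal[OF assms] ..

section \<open>Stationary chains indexed by the integers\<close>

text \<open>
  Each further step multiplies the probability by an entry of \<open>M\<close>. The Markov property gives this
  for pasts of positive probability; after the other pasts both sides vanish.
\<close>

lemma stationary_markov_chain_path_prob:
  assumes "stationary_markov_chain P M \<pi> Y"
  shows "\<P>(\<omega> in P. \<forall>l\<in>{m..m + int n}. Y l \<omega> = y l)
    = \<pi> (y m) * (\<Prod>k<n. M (y (m + int k)) (y (m + int (Suc k))))"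
proof (induction n)
  case 0
  then show ?case
    using assms by (simp add: stationary_markov_chain_def)
next
  case (Suc n)
  interpret prob_space P
    using assms by (simp add: stationary_markov_chain_def markov_chain_def)
  have [measurable]: "Y k \<in> measurable P (count_space UNIV)" for k
    using assms by (simp add: stationary_markov_chain_def markov_chain_def)
  let ?e = "m + int n"
  let ?past = "\<lambda>\<omega>. \<forall>l\<in>{m..?e}. Y l \<omega> = y l"
  have step: "\<P>(\<omega> in P. Y (?e + 1) \<omega> = y (?e + 1) \<bar> ?past \<omega>) = M (y ?e) (y (?e + 1))"
    if "\<P>(\<omega> in P. ?past \<omega>) > 0"
  proof -
    have "\<P>(\<omega> in P. \<forall>l\<in>{?e - int n..?e}. Y l \<omega> = y l) > 0 \<longrightarrow>
        \<P>(\<omega> in P. Y (?e + 1) \<omega> = y (?e + 1) \<bar> \<forall>l\<in>{?e - int n..?e}. Y l \<omega> = y l)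
          = M (y ?e) (y (?e + 1))"
      using assms unfolding stationary_markov_chain_def markov_chain_def by blast
    then show ?thesis
      using that by simp
  qed
  have "{m..m + int (Suc n)} = insert (?e + 1) {m..?e}"
    by auto
  then have split: "\<P>(\<omega> in P. \<forall>l\<in>{m..m + int (Suc n)}. Y l \<omega> = y l)
      = \<P>(\<omega> in P. Y (?e + 1) \<omega> = y (?e + 1) \<and> ?past \<omega>)"
    by simp
  also have "\<dots> = \<P>(\<omega> in P. ?past \<omega>) * M (y ?e) (y (?e + 1))"
  proof (cases "\<P>(\<omega> in P. ?past \<omega>) > 0")
    case True
    then show ?thesis
      using step by (auto simp: cond_prob_def field_simps)
  next
    case False
    moreover have "\<P>(\<omega> in P. Y (?e + 1) \<omega> = y (?e + 1) \<and> ?past \<omega>) \<le> \<P>(\<omega> in P. ?past \<omega>)"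
      by (rule finite_measure_mono) auto
    ultimately show ?thesis
      using measure_nonneg[of P "{\<omega> \<in> space P. ?past \<omega>}"]
        measure_nonneg[of P "{\<omega> \<in> space P. Y (?e + 1) \<omega> = y (?e + 1) \<and> ?past \<omega>}"]
      by simp
  qed
  finally show ?case
    by (simp add: Suc.IH algebra_simps)
qed

text \<open>
  For the reversed chain, a step from \<open>a\<close> to \<open>b\<close> prepends \<open>b\<close> to a path of the original one. In
  the path probability this replaces the initial factor \<open>\<pi> a\<close> by \<open>\<pi> b * M b a\<close>. Conditioning on a
  past of positive probability keeps the divisor \<open>\<pi> a\<close> away from zero.
\<close>

lemma stationary_markov_chain_time_reversal:
  assumes Y: "stationary_markov_chain P M \<pi> Y"
  shows "stationary_markov_chain P (time_reversal \<pi> M) \<pi> (\<lambda>k. Y (- k))"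
  unfolding stationary_markov_chain_def markov_chain_def
proof (intro conjI allI impI)
  show "prob_space P" "Y (- k) \<in> measurable P (count_space UNIV)" "\<P>(\<omega> in P. Y (- k) \<omega> = i) = \<pi> i"
    for k i
    using Y by (auto simp: stationary_markov_chain_def markov_chain_def)
next
  fix k :: int and n :: nat and x :: "int \<Rightarrow> nat"
  let ?past = "\<lambda>\<omega>. \<forall>l\<in>{k - int n..k}. Y (- l) \<omega> = x l"
  assume pos_past: "\<P>(\<omega> in P. ?past \<omega>) > 0"
  let ?y = "\<lambda>l. x (- l)"
  have flip: "(\<forall>l\<in>{a..b}. Y (- l) \<omega> = x l) \<longleftrightarrow> (\<forall>l\<in>{- b..- a}. Y l \<omega> = ?y l)" for a b \<omega>
  proof -
    have "(\<forall>l\<in>{a..b}. Q l) \<longleftrightarrow> (\<forall>l\<in>uminus ` {- b..- a}. Q l)" for Q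
      by simp
    then show ?thesis
      by (simp only: Set.ball_simps(9) minus_minus)
  qed
  have past: "\<P>(\<omega> in P. ?past \<omega>)
      = \<pi> (x k) * (\<Prod>j<n. M (?y (- k + int j)) (?y (- k + int (Suc j))))"
    using stationary_markov_chain_path_prob[OF Y, of "- k" n ?y] by (simp add: flip)
  have nonzero: "(\<Prod>j<n. M (?y (- k + int j)) (?y (- k + int (Suc j)))) \<noteq> 0"
    using pos_past unfolding past by (metis less_irrefl mult_zero_right)
  \<comment> \<open>Reversed in time, the step is the first one of a path which starts at time \<open>- (k + 1)\<close>.\<close>
  have "(Y (- (k + 1)) \<omega> = x (k + 1) \<and> ?past \<omega>) \<longleftrightarrow>
      (\<forall>l\<in>{- (k + 1)..- (k + 1) + int (Suc n)}. Y l \<omega> = ?y l)" for \<omega>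
  proof -
    have "{- (k + 1)..- (k + 1) + int (Suc n)} = insert (- (k + 1)) {- k..- (k - int n)}"
      by auto
    then show ?thesis
      by (simp add: flip add.commute)
  qed
  then have "\<P>(\<omega> in P. Y (- (k + 1)) \<omega> = x (k + 1) \<and> ?past \<omega>)
      = \<pi> (x (k + 1)) * (\<Prod>j<Suc n. M (?y (- (k + 1) + int j)) (?y (- (k + 1) + int (Suc j))))"
    using stationary_markov_chain_path_prob[OF Y, of "- (k + 1)" "Suc n" ?y] by (simp add: add.commute)
  also have "\<dots> = \<pi> (x (k + 1)) * M (x (k + 1)) (x k) *
      (\<Prod>j<n. M (?y (- k + int j)) (?y (- k + int (Suc j))))"
    by (subst prod.lessThan_Suc_shift) (simp add: algebra_simps)
  finally show "\<P>(\<omega> in P. Y (- (k + 1)) \<omega> = x (k + 1) \<bar> ?past \<omega>)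
      = time_reversal \<pi> M (x k) (x (k + 1))"
    using nonzero by (simp add: cond_prob_def past time_reversal_def)
qed

section \<open>Time reversal of an almost upper-triangular chain\<close>

theorem theorem3p1:
  fixes U L :: "nat \<Rightarrow> nat \<Rightarrow> real"
    and \<pi> :: "nat \<Rightarrow> real"
  assumes U_transition: "transition_matrix U"
    and U_irreducible: "irreducible_matrix U"
    and U_triangular: "almost_upper_triangular U"
    and U_invariant: "invariant_measure U \<pi>"
    and L_def: "\<And>i j. L i j = \<pi> j * U j i / \<pi> i"
  shows "(transition_matrix L \<and> irreducible_matrix L \<and> almost_lower_triangular L \<and>
            invariant_measure L \<pi>) \<and>
         (recurrent L \<longleftrightarrow> recurrent U) \<and>
         (\<pi> sums 1 \<longrightarrow>
            (\<forall>(P :: 'w measure) Y. stationary_markov_chain P U \<pi> Y \<longrightarrow>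
               stationary_markov_chain P L \<pi> (\<lambda>k. Y (- k)))) \<and>
         (positive_recurrent L \<longleftrightarrow> positive_recurrent U)"
proof -
  have L: "L = time_reversal \<pi> U"
    by (simp add: fun_eq_iff L_def time_reversal_def)
  have pos: "0 < \<pi> i" for i
    by (rule invariant_measure_pos[OF U_transition U_irreducible U_invariant])
  show ?thesis
    unfolding L
    using assms(1-4) pos
    by (simp add: transition_matrix_time_reversal irreducible_matrix_time_reversal
        almost_lower_triangular_time_reversal invariant_measure_time_reversal
        recurrent_time_reversal positive_recurrent_time_reversal
        stationary_markov_chain_time_reversal)
qed

end
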